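(* Let $K$ be any field. The derived algebra $[\mathfrak{gl}_{cf}(\mathbb{N},K),\mathfrak{gl}_{cf}(\mathbb{N},K)]$ of $\mathfrak{gl}_{cf}(\mathbb{N},K)$ coincides with $\mathfrak{gl}_{cf}(\mathbb{N},K)$, i.e. $\mathfrak{gl}_{cf}(\mathbb{N},K)$ is perfect. The ideal $\mathfrak{d}_{sc}(\mathbb{N},K)$ is the center of $\mathfrak{gl}_{cf}(\mathbb{N},K)$.
   Context: $\mathbb{N}$ denotes the positive integers and $K$ is a field. $\mathfrak{gl}_{cf}(\mathbb{N},K)$ is the set of all $\mathbb{N}\times\mathbb{N}$ matrices over $K$ having only finitely many nonzero entries in each column, regarded as a Lie algebra over $K$ with $[A,B]=AB-BA$. $\mathfrak{d}_{sc}(\mathbb{N},K)=\{\alpha E:\alpha\in K\}$, where $E$ is the infinite identity matrix. *)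

theory Defs
  imports Complex_Main "HOL-Library.Function_Algebras" "HOL-Library.Groups_Big_Fun"
begin

locale lie_algebra = vector_space scale
  for scale :: "'k::field \<Rightarrow> 'v::ab_group_add \<Rightarrow> 'v" +
  fixes L :: "'v set" and bracket :: "'v \<Rightarrow> 'v \<Rightarrow> 'v"
  assumes subspace_L: "subspace L"
    and bracket_closed: "x \<in> L \<Longrightarrow> y \<in> L \<Longrightarrow> bracket x y \<in> L"
    and bracket_add_left:
      "x \<in> L \<Longrightarrow> y \<in> L \<Longrightarrow> z \<in> L \<Longrightarrow> bracket (x + y) z = bracket x z + bracket y z"
    and bracket_add_right:
      "x \<in> L \<Longrightarrow> y \<in> L \<Longrightarrow> z \<in> L \<Longrightarrow> bracket x (y + z) = bracket x y + bracket x z"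
    and bracket_scale_left:
      "x \<in> L \<Longrightarrow> y \<in> L \<Longrightarrow> bracket (scale c x) y = scale c (bracket x y)"
    and bracket_scale_right:
      "x \<in> L \<Longrightarrow> y \<in> L \<Longrightarrow> bracket x (scale c y) = scale c (bracket x y)"
    and bracket_alternating: "x \<in> L \<Longrightarrow> bracket x x = 0"
    and jacobi: "x \<in> L \<Longrightarrow> y \<in> L \<Longrightarrow> z \<in> L \<Longrightarrow>
      bracket x (bracket y z) + bracket y (bracket z x) + bracket z (bracket x y) = 0"
begin

definition derived_algebra :: "'v set" where
  "derived_algebra = span {bracket x y | x y. x \<in> L \<and> y \<in> L}"

definition ideal :: "'v set \<Rightarrow> bool" where
  "ideal I \<longleftrightarrow> subspace I \<and> I \<subseteq> L \<and> (\<forall>x\<in>L. \<forall>y\<in>I. bracket x y \<in> I)"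

definition center :: "'v set" where
  "center = {z \<in> L. \<forall>x\<in>L. bracket z x = 0}"

end

text \<open>
  An infinite matrix is a function from row and column index to entries. Indices start at 0:
  \<open>A i j\<close> is the entry in row \<open>i + 1\<close> and column \<open>j + 1\<close>. Addition, subtraction and zero are the
  pointwise ones of \<open>Function_Algebras\<close>; the product \<open>(*)\<close> of that theory is entrywise and is not
  the matrix product.
\<close>

type_synonym 'k inf_mat = "nat \<Rightarrow> nat \<Rightarrow> 'k"

definition mat_scale :: "'k::field \<Rightarrow> 'k inf_mat \<Rightarrow> 'k inf_mat" where
  "mat_scale c A = (\<lambda>i j. c * A i j)"

text \<open>
  \<open>Sum_any\<close> adds up the nonzero terms and is 0 if there are infinitely many; the latter does not
  happen when \<open>B\<close> has finitely many nonzero entries in each column.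
\<close>

definition mat_mult :: "'k::field inf_mat \<Rightarrow> 'k inf_mat \<Rightarrow> 'k inf_mat" where
  "mat_mult A B = (\<lambda>i j. Sum_any (\<lambda>k. A i k * B k j))"

definition commutator :: "'k::field inf_mat \<Rightarrow> 'k inf_mat \<Rightarrow> 'k inf_mat" where
  "commutator A B = mat_mult A B - mat_mult B A"

definition mat_one :: "'k::field inf_mat" where
  "mat_one = (\<lambda>i j. if i = j then 1 else 0)"

definition gl_cf :: "'k::field inf_mat set" where
  "gl_cf = {A. \<forall>j. finite {i. A i j \<noteq> 0}}"

definition d_sc :: "'k::field inf_mat set" where
  "d_sc = {mat_scale \<alpha> mat_one | \<alpha>. True}"

lemma mat_mult_eq_sum:
  assumes "finite S" "{k. B k j \<noteq> 0} \<subseteq> S"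
  shows "mat_mult A B i j = (\<Sum>k\<in>S. A i k * B k j)"
  unfolding mat_mult_def by (rule Sum_any.expand_superset) (use assms in auto)

lemma gl_cf_add:
  assumes "A \<in> gl_cf" "B \<in> gl_cf"
  shows "A + B \<in> gl_cf"
proof -
  have "finite {i. (A + B) i j \<noteq> 0}" for j
  proof (rule finite_subset)
    show "{i. (A + B) i j \<noteq> 0} \<subseteq> {i. A i j \<noteq> 0} \<union> {i. B i j \<noteq> 0}" by auto
    show "finite ({i. A i j \<noteq> 0} \<union> {i. B i j \<noteq> 0})" using assms by (simp add: gl_cf_def)
  qed
  then show ?thesis by (simp add: gl_cf_def)
qed

lemma gl_cf_scale: "A \<in> gl_cf \<Longrightarrow> mat_scale c A \<in> gl_cf"
  by (auto simp: gl_cf_def mat_scale_def)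

lemma gl_cf_diff:
  assumes "A \<in> gl_cf" "B \<in> gl_cf"
  shows "A - B \<in> gl_cf"
proof -
  have "finite {i. (A - B) i j \<noteq> 0}" for j
  proof (rule finite_subset)
    show "{i. (A - B) i j \<noteq> 0} \<subseteq> {i. A i j \<noteq> 0} \<union> {i. B i j \<noteq> 0}" by auto
    show "finite ({i. A i j \<noteq> 0} \<union> {i. B i j \<noteq> 0})" using assms by (simp add: gl_cf_def)
  qed
  then show ?thesis by (simp add: gl_cf_def)
qed

lemma gl_cf_mult:
  assumes "A \<in> gl_cf" "B \<in> gl_cf"
  shows "mat_mult A B \<in> gl_cf"
  unfolding gl_cf_def mem_Collect_eq
proof
  fix j
  let ?S = "{k. B k j \<noteq> 0}"
  have S: "finite ?S" using assms by (auto simp: gl_cf_def)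
  have "{i. mat_mult A B i j \<noteq> 0} \<subseteq> (\<Union>k\<in>?S. {i. A i k \<noteq> 0})"
  proof
    fix i assume "i \<in> {i. mat_mult A B i j \<noteq> 0}"
    then have "(\<Sum>k\<in>?S. A i k * B k j) \<noteq> 0"
      using mat_mult_eq_sum[OF S, of B j A i] by auto
    then obtain k where "k \<in> ?S" "A i k * B k j \<noteq> 0"
      by (meson sum.neutral)
    then show "i \<in> (\<Union>k\<in>?S. {i. A i k \<noteq> 0})" by auto
  qed
  moreover have "finite (\<Union>k\<in>?S. {i. A i k \<noteq> 0})"
    using S assms by (auto simp: gl_cf_def)
  ultimately show "finite {i. mat_mult A B i j \<noteq> 0}" by (rule finite_subset)
qed

lemma mat_mult_add_left:
  assumes "C \<in> gl_cf"
  shows "mat_mult (A + B) C = mat_mult A C + mat_mult B C"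
proof (intro ext)
  fix i j
  have "finite {k. C k j \<noteq> 0}" using assms by (auto simp: gl_cf_def)
  from mat_mult_eq_sum[of _ C j, OF this subset_refl]
  show "mat_mult (A + B) C i j = (mat_mult A C + mat_mult B C) i j"
    by (simp add: distrib_right sum.distrib)
qed

lemma mat_mult_add_right:
  assumes "B \<in> gl_cf" "C \<in> gl_cf"
  shows "mat_mult A (B + C) = mat_mult A B + mat_mult A C"
proof (intro ext)
  fix i j
  let ?S = "{k. B k j \<noteq> 0} \<union> {k. C k j \<noteq> 0}"
  have S: "finite ?S" using assms by (auto simp: gl_cf_def)
  have "mat_mult A (B + C) i j = (\<Sum>k\<in>?S. A i k * (B + C) k j)"
    by (rule mat_mult_eq_sum[OF S]) auto
  moreover have "mat_mult A B i j = (\<Sum>k\<in>?S. A i k * B k j)"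
    by (rule mat_mult_eq_sum[OF S]) auto
  moreover have "mat_mult A C i j = (\<Sum>k\<in>?S. A i k * C k j)"
    by (rule mat_mult_eq_sum[OF S]) auto
  ultimately show "mat_mult A (B + C) i j = (mat_mult A B + mat_mult A C) i j"
    by (simp add: distrib_left sum.distrib)
qed

lemma mat_mult_scale_left:
  assumes "B \<in> gl_cf"
  shows "mat_mult (mat_scale c A) B = mat_scale c (mat_mult A B)"
proof (intro ext)
  fix i j
  have "finite {k. B k j \<noteq> 0}" using assms by (auto simp: gl_cf_def)
  from mat_mult_eq_sum[of _ B j, OF this subset_refl]
  show "mat_mult (mat_scale c A) B i j = mat_scale c (mat_mult A B) i j"
    by (simp add: mat_scale_def sum_distrib_left mult.assoc)
qed

lemma mat_mult_scale_right:
  assumes "B \<in> gl_cf"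
  shows "mat_mult A (mat_scale c B) = mat_scale c (mat_mult A B)"
proof (intro ext)
  fix i j
  have S: "finite {k. B k j \<noteq> 0}" using assms by (auto simp: gl_cf_def)
  have "mat_mult A (mat_scale c B) i j = (\<Sum>k | B k j \<noteq> 0. A i k * mat_scale c B k j)"
    by (rule mat_mult_eq_sum[OF S]) (auto simp: mat_scale_def)
  then show "mat_mult A (mat_scale c B) i j = mat_scale c (mat_mult A B) i j"
    using mat_mult_eq_sum[of _ B j, OF S subset_refl]
    by (simp add: mat_scale_def sum_distrib_left mult.left_commute)
qed

lemma mat_mult_assoc:
  assumes "B \<in> gl_cf" "C \<in> gl_cf"
  shows "mat_mult (mat_mult A B) C = mat_mult A (mat_mult B C)"
proof (intro ext)
  fix i j
  let ?S = "{k. C k j \<noteq> 0}"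
  let ?T = "\<Union>k\<in>?S. {l. B l k \<noteq> 0}"
  have S: "finite ?S" using assms by (auto simp: gl_cf_def)
  have T: "finite ?T" using S assms by (auto simp: gl_cf_def)
  have BC: "mat_mult B C l j = (\<Sum>k\<in>?S. B l k * C k j)" for l
    by (rule mat_mult_eq_sum[OF S]) simp
  have "mat_mult (mat_mult A B) C i j = (\<Sum>k\<in>?S. mat_mult A B i k * C k j)"
    by (rule mat_mult_eq_sum[OF S]) simp
  also have "\<dots> = (\<Sum>k\<in>?S. \<Sum>l\<in>?T. A i l * B l k * C k j)"
  proof (rule sum.cong[OF refl])
    fix k assume "k \<in> ?S"
    then have "mat_mult A B i k = (\<Sum>l\<in>?T. A i l * B l k)"
      by (intro mat_mult_eq_sum[OF T]) auto
    then show "mat_mult A B i k * C k j = (\<Sum>l\<in>?T. A i l * B l k * C k j)"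
      by (simp add: sum_distrib_right)
  qed
  also have "\<dots> = (\<Sum>l\<in>?T. A i l * mat_mult B C l j)"
    by (subst sum.swap) (simp add: BC sum_distrib_left mult.assoc)
  also have "\<dots> = mat_mult A (mat_mult B C) i j"
  proof (rule mat_mult_eq_sum[OF T, symmetric], rule subsetI)
    fix l assume "l \<in> {l. mat_mult B C l j \<noteq> 0}"
    then have "(\<Sum>k\<in>?S. B l k * C k j) \<noteq> 0" by (simp add: BC)
    then obtain k where "k \<in> ?S" "B l k * C k j \<noteq> 0" by (meson sum.neutral)
    then show "l \<in> ?T" by auto
  qed
  finally show "mat_mult (mat_mult A B) C i j = mat_mult A (mat_mult B C) i j" .
qed

lemma mat_mult_diff_left:
  assumes "A \<in> gl_cf" "B \<in> gl_cf" "C \<in> gl_cf"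
  shows "mat_mult (A - B) C = mat_mult A C - mat_mult B C"
  using mat_mult_add_left[OF assms(3), of "A - B" B] by (simp add: eq_diff_eq)

lemma mat_mult_diff_right:
  assumes "B \<in> gl_cf" "C \<in> gl_cf"
  shows "mat_mult A (B - C) = mat_mult A B - mat_mult A C"
  using mat_mult_add_right[OF gl_cf_diff[OF assms] assms(2), of A] by (simp add: eq_diff_eq)

lemma vector_space_mat_scale: "vector_space mat_scale"
  by unfold_locales (auto simp: mat_scale_def fun_eq_iff algebra_simps)

lemma jacobi_sum:
  fixes abc acb bca bac cab cba :: "'v::ab_group_add"
  shows "abc - acb - (bca - cba) + (bca - bac - (cab - acb)) + (cab - cba - (abc - bac)) = 0"
  by (simp add: algebra_simps)

interpretation gl: lie_algebra mat_scale gl_cf commutator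
proof (intro lie_algebra.intro lie_algebra_axioms.intro)
  interpret vector_space mat_scale by (rule vector_space_mat_scale)
  show "vector_space mat_scale" by (rule vector_space_mat_scale)
  show "subspace gl_cf"
  proof (rule subspaceI)
    show "0 \<in> gl_cf" by (simp add: gl_cf_def)
  qed (auto intro: gl_cf_add gl_cf_scale)
next
  fix A B C :: "'a inf_mat" and c
  assume A: "A \<in> gl_cf" and B: "B \<in> gl_cf"
  interpret vector_space mat_scale by (rule vector_space_mat_scale)
  show "commutator A B \<in> gl_cf"
    unfolding commutator_def using A B by (intro gl_cf_diff gl_cf_mult)
  show "commutator (mat_scale c A) B = mat_scale c (commutator A B)"
    unfolding commutator_def mat_mult_scale_left[OF B] mat_mult_scale_right[OF A]
    by (rule scale_right_diff_distrib[symmetric])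
  show "commutator A (mat_scale c B) = mat_scale c (commutator A B)"
    unfolding commutator_def mat_mult_scale_left[OF A] mat_mult_scale_right[OF B]
    by (rule scale_right_diff_distrib[symmetric])
  show "commutator A A = 0"
    unfolding commutator_def by (rule diff_self)
  assume C: "C \<in> gl_cf"
  show "commutator (A + B) C = commutator A C + commutator B C"
    unfolding commutator_def mat_mult_add_left[OF C] mat_mult_add_right[OF A B]
    by (rule add_diff_add)
  show "commutator A (B + C) = commutator A B + commutator A C"
    unfolding commutator_def mat_mult_add_left[OF A] mat_mult_add_right[OF B C]
    by (rule add_diff_add)
  show "commutator A (commutator B C) + commutator B (commutator C A)
      + commutator C (commutator A B) = 0"
    unfolding commutator_def
    by (simp only: mat_mult_diff_left mat_mult_diff_right mat_mult_assoc A B C gl_cf_mult)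
       (rule jacobi_sum)
qed

end

theory Submission
  imports Defs
begin

text \<open>
  Column-finite matrices are the endomorphisms of the space of finitely supported column vectors,
  with basis \<open>e\<^sub>0, e\<^sub>1, \<dots>\<close>. Let \<open>D\<close> be the backward shift, sending \<open>e\<^sub>0\<close> to \<open>0\<close> and
  \<open>e\<^sub>j\<close> to \<open>e\<^sub>j\<^sub>-\<^sub>1\<close> for \<open>j > 0\<close>. It is onto, with the forward shift \<open>U\<close> as a right inverse.
  Hence the equation \<open>D X - X D = A\<close>, which on the basis reads
  \<open>D (X e\<^sub>j) = A e\<^sub>j + X e\<^sub>j\<^sub>-\<^sub>1\<close> with \<open>X e\<^sub>-\<^sub>1 = 0\<close>, can be solved for every \<open>A\<close>, one
  column after the other, by \<open>X e\<^sub>j = U (A e\<^sub>j + X e\<^sub>j\<^sub>-\<^sub>1)\<close>. Each column of the solution is finitely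
  supported, so every \<open>A\<close> is a single commutator (lemma \<open>commutator_shift_shift_solution\<close>) and
  the algebra is perfect. In finite dimension commutators have trace zero, and the argument breaks
  down because no backward shift is onto.

  A central matrix commutes with all matrix units, which forces it to be diagonal with constant
  diagonal, and scalar matrices clearly commute with everything (lemma \<open>center_gl_cf\<close>). That the
  scalar matrices form an ideal is then the fact that the center of a Lie algebra is one.
\<close>

lemma (in lie_algebra) bracket_antisym:
  assumes "x \<in> L" "y \<in> L"
  shows "bracket x y = - bracket y x"
proof -
  have "x + y \<in> L" using assms subspace_L by (simp add: subspace_add)
  then have "0 = bracket x x + bracket x y + (bracket y x + bracket y y)"
    using assms bracket_alternating[of "x + y"]
    by (simp add: bracket_add_left bracket_add_right ac_simps)
  then have "bracket x y + bracket y x = 0"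
    using assms by (simp add: bracket_alternating)
  then show ?thesis by (simp add: eq_neg_iff_add_eq_0)
qed

lemma (in lie_algebra) ideal_center: "ideal center"
  unfolding ideal_def
proof (intro conjI ballI)
  show "subspace center"
  proof (rule subspaceI)
    have "bracket 0 x = 0" if "x \<in> L" for x
      using that bracket_add_left[of 0 0 x] subspace_L by (simp add: subspace_0)
    then show "0 \<in> center" using subspace_L by (simp add: center_def subspace_0)
  next
    fix x y assume "x \<in> center" "y \<in> center"
    then show "x + y \<in> center"
      using subspace_L by (simp add: center_def subspace_add bracket_add_left)
  next
    fix c x assume "x \<in> center"
    then show "scale c x \<in> center"
      using subspace_L by (simp add: center_def subspace_scale bracket_scale_left)
  qed
  then have "0 \<in> center" by (rule subspace_0)
  show "center \<subseteq> L" by (auto simp: center_def)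
  fix x y assume x: "x \<in> L" and y: "y \<in> center"
  then have "bracket x y = 0" using bracket_antisym[of x y] by (simp add: center_def)
  then show "bracket x y \<in> center" using \<open>0 \<in> center\<close> by simp
qed

definition back_shift :: "'k::field inf_mat" where
  "back_shift = (\<lambda>i j. if j = Suc i then 1 else 0)"

text \<open>The columns \<open>X e\<^sub>j = U (A e\<^sub>j + X e\<^sub>j\<^sub>-\<^sub>1)\<close>; the column index comes before the row index here
  because the recursion runs over it.\<close>

primrec shift_solution_col :: "'k::field inf_mat \<Rightarrow> nat \<Rightarrow> nat \<Rightarrow> 'k" where
  "shift_solution_col A 0 = (\<lambda>i. case i of 0 \<Rightarrow> 0 | Suc m \<Rightarrow> A m 0)"
| "shift_solution_col A (Suc j) =
    (\<lambda>i. case i of 0 \<Rightarrow> 0 | Suc m \<Rightarrow> A m (Suc j) + shift_solution_col A j m)"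

definition shift_solution :: "'k::field inf_mat \<Rightarrow> 'k inf_mat" where
  "shift_solution A = (\<lambda>i j. shift_solution_col A j i)"

lemma mat_mult_eq_single:
  assumes "\<And>k. k \<noteq> l \<Longrightarrow> A i k * B k j = 0"
  shows "mat_mult A B i j = A i l * B l j"
proof -
  have "mat_mult A B i j = (\<Sum>k\<in>{l}. A i k * B k j)"
    unfolding mat_mult_def by (rule Sum_any.expand_superset) (use assms in auto)
  then show ?thesis by simp
qed

lemma back_shift_mult: "mat_mult back_shift X i j = X (Suc i) j"
  by (subst mat_mult_eq_single[where l = "Suc i"]) (auto simp: back_shift_def)

lemma mult_back_shift:
  "mat_mult X back_shift i j = (case j of 0 \<Rightarrow> 0 | Suc m \<Rightarrow> X i m)"
  by (subst mat_mult_eq_single[where l = "j - 1"]) (auto simp: back_shift_def split: nat.split)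

lemma back_shift_gl_cf: "back_shift \<in> gl_cf"
proof -
  have "finite {i. back_shift i j \<noteq> (0::'a)}" for j
    by (rule finite_subset[of _ "{..j}"]) (auto simp: back_shift_def split: if_splits)
  then show ?thesis by (simp add: gl_cf_def)
qed

lemma shift_solution_gl_cf:
  assumes "A \<in> gl_cf"
  shows "shift_solution A \<in> gl_cf"
proof -
  have A: "finite {i. A i j \<noteq> 0}" for j using assms by (simp add: gl_cf_def)
  have "finite {i. shift_solution_col A j i \<noteq> 0}" for j
  proof (induction j)
    case 0
    have "{i. shift_solution_col A 0 i \<noteq> 0} \<subseteq> Suc ` {i. A i 0 \<noteq> 0}"
      by (auto split: nat.split_asm)
    then show ?case using A by (blast intro: finite_subset)
  next
    case (Suc j)
    have "{i. shift_solution_col A (Suc j) i \<noteq> 0}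
        \<subseteq> Suc ` ({i. A i (Suc j) \<noteq> 0} \<union> {i. shift_solution_col A j i \<noteq> 0})"
      by (auto split: nat.split_asm simp del: image_Un intro!: imageI)
    then show ?case using A Suc by (blast intro: finite_subset)
  qed
  then show ?thesis by (simp add: gl_cf_def shift_solution_def)
qed

lemma commutator_shift_shift_solution: "commutator back_shift (shift_solution A) = A"
proof (intro ext)
  fix i j
  show "commutator back_shift (shift_solution A) i j = A i j"
    by (cases j) (simp_all add: commutator_def back_shift_mult mult_back_shift shift_solution_def)
qed

lemma derived_algebra_gl_cf: "gl.derived_algebra = (gl_cf :: 'k::field inf_mat set)"
proof
  show "gl.derived_algebra \<subseteq> (gl_cf :: 'k inf_mat set)"
    unfolding gl.derived_algebra_def
    by (rule gl.span_minimal) (auto intro: gl.bracket_closed gl.subspace_L)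
  show "gl_cf \<subseteq> (gl.derived_algebra :: 'k inf_mat set)"
  proof
    fix A :: "'k inf_mat" assume "A \<in> gl_cf"
    then have "A \<in> {commutator B C | B C. B \<in> gl_cf \<and> C \<in> gl_cf}"
      using back_shift_gl_cf shift_solution_gl_cf commutator_shift_shift_solution[of A, symmetric]
      by blast
    then show "A \<in> gl.derived_algebra"
      unfolding gl.derived_algebra_def by (rule gl.span_base)
  qed
qed

definition mat_unit :: "nat \<Rightarrow> nat \<Rightarrow> 'k::field inf_mat" where
  "mat_unit a b = (\<lambda>i j. if i = a \<and> j = b then 1 else 0)"

lemma mat_unit_gl_cf: "mat_unit a b \<in> gl_cf"
proof -
  have "finite {i. mat_unit a b i j \<noteq> (0::'a)}" for j
    by (rule finite_subset[of _ "{a}"]) (auto simp: mat_unit_def split: if_splits)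
  then show ?thesis by (simp add: gl_cf_def)
qed

lemma mult_mat_unit: "mat_mult Z (mat_unit a b) i j = (if j = b then Z i a else 0)"
  by (subst mat_mult_eq_single[where l = a]) (auto simp: mat_unit_def)

lemma mat_unit_mult: "mat_mult (mat_unit a b) Z i j = (if i = a then Z b j else 0)"
  by (subst mat_mult_eq_single[where l = b]) (auto simp: mat_unit_def)

lemma mat_one_gl_cf: "mat_one \<in> gl_cf"
  by (simp add: gl_cf_def mat_one_def)

lemma mat_one_mult: "mat_mult mat_one A = A"
proof (intro ext)
  show "mat_mult mat_one A i j = A i j" for i j
    by (subst mat_mult_eq_single[where l = i]) (auto simp: mat_one_def)
qed

lemma mult_mat_one: "mat_mult A mat_one = A"
proof (intro ext)
  show "mat_mult A mat_one i j = A i j" for i j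
    by (subst mat_mult_eq_single[where l = j]) (auto simp: mat_one_def)
qed

text \<open>
  Comparing the entries in row \<open>i\<close> and column \<open>b\<close> of \<open>Z E\<close> and \<open>E Z\<close>, where \<open>E\<close> is the matrix
  unit at \<open>(a, b)\<close>, gives \<open>Z i a = 0\<close> for \<open>i \<noteq> a\<close> and \<open>Z a a = Z b b\<close>.
\<close>

lemma center_gl_cf: "gl.center = (d_sc :: 'k::field inf_mat set)"
proof
  show "gl.center \<subseteq> (d_sc :: 'k inf_mat set)"
  proof
    fix Z :: "'k inf_mat" assume "Z \<in> gl.center"
    then have comm: "mat_mult Z (mat_unit a b) = mat_mult (mat_unit a b) Z" for a b
      using mat_unit_gl_cf[of a b] by (auto simp: gl.center_def commutator_def)
    have entry: "Z i a = (if i = a then Z b b else 0)" for i a b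
      using fun_cong[OF fun_cong[OF comm[of a b], of i], of b]
      by (simp add: mult_mat_unit mat_unit_mult)
    have "Z = mat_scale (Z 0 0) mat_one"
    proof (intro ext)
      show "Z i j = mat_scale (Z 0 0) mat_one i j" for i j
        using entry[of i j 0] by (simp add: mat_scale_def mat_one_def)
    qed
    then show "Z \<in> d_sc" by (auto simp: d_sc_def)
  qed
  show "(d_sc :: 'k inf_mat set) \<subseteq> gl.center"
  proof
    fix Z :: "'k inf_mat" assume "Z \<in> d_sc"
    then obtain c where Z: "Z = mat_scale c mat_one" by (auto simp: d_sc_def)
    have "commutator Z X = 0" if "X \<in> gl_cf" for X
      using that unfolding Z
      by (simp add: commutator_def mat_mult_scale_left mat_mult_scale_right mat_one_gl_cf
          mat_one_mult mult_mat_one)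
    then show "Z \<in> gl.center"
      using gl_cf_scale[OF mat_one_gl_cf, of c] by (simp add: gl.center_def Z)
  qed
qed

theorem corollary1p3:
  "gl.derived_algebra = (gl_cf :: 'k::field inf_mat set)
   \<and> gl.ideal (d_sc :: 'k inf_mat set)
   \<and> gl.center = (d_sc :: 'k inf_mat set)"
  using derived_algebra_gl_cf center_gl_cf gl.ideal_center by metis

end
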